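(* For $n\ge 2$ and $m\ge 4$, $sn(C_{2n}(K_m^-))=(m-3)n+1$.
   Context: Graphs are finite, undirected and simple. $C_{2n}(K_m)$ is the graph obtained from a $2n$-cycle $C_{2n}=x_1x_2\cdots x_{2n}x_1$ and $n$ pairwise disjoint copies $K^1,\dots,K^n$ of the complete graph $K_m$ by identifying, for each $1\le i\le n$, the edge $x_{2i-1}x_{2i}$ of the cycle with an edge of $K^i$. $C_{2n}(K_m^-)$ is the graph obtained from $C_{2n}(K_m)$ by removing the $n$ edges $x_{2i-1}x_{2i}$, $1\le i\le n$. Let $G=(V,E)$ be a connected graph with chromatic number $\chi(G)=k\ge 2$. For $S\subset V$, a partial coloring on $G[S]$ is a proper coloring $\mathscr C_0$ of the induced subgraph $G[S]$ with colors from $\{1,\dots,k\}$ (not all colors need be used). It is a Sudoku coloring of $G$ if there is exactly one proper $k$-coloring $V\to\{1,\dots,k\}$ of $G$ whose restriction to $S$ is $\mathscr C_0$. The Sudoku number $sn(G)$ is the smallest $|S|$ such that $G[S]$ admits a Sudoku coloring of $G$. *)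

theory Defs
  imports "HOL-Library.FuncSet"
begin

text \<open>A graph is a pair (vertex set, edge set); an edge is a two-element set of vertices.\<close>

type_synonym 'a graph = "'a set \<times> 'a set set"

definition simple_graph :: "'a graph \<Rightarrow> bool" where
  "simple_graph G \<longleftrightarrow> finite (fst G) \<and> (\<forall>e\<in>snd G. e \<subseteq> fst G \<and> card e = 2)"

definition induced_subgraph :: "'a graph \<Rightarrow> 'a set \<Rightarrow> 'a graph" where
  "induced_subgraph G S = (S, {e \<in> snd G. e \<subseteq> S})"

text \<open>Colorings are extensional functions (undefined outside the vertex set), so that counting them
  is counting maps on the vertex set. Not all colors need be used.\<close>

definition proper_coloring :: "'a graph \<Rightarrow> nat \<Rightarrow> ('a \<Rightarrow> nat) \<Rightarrow> bool" where
  "proper_coloring G k c \<longleftrightarrow>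
     c \<in> fst G \<rightarrow>\<^sub>E {1..k} \<and> (\<forall>u v. {u, v} \<in> snd G \<longrightarrow> c u \<noteq> c v)"

definition chromatic_number :: "'a graph \<Rightarrow> nat" where
  "chromatic_number G = (LEAST k. \<exists>c. proper_coloring G k c)"

definition sudoku_coloring :: "'a graph \<Rightarrow> 'a set \<Rightarrow> ('a \<Rightarrow> nat) \<Rightarrow> bool" where
  "sudoku_coloring G S c0 \<longleftrightarrow>
     S \<subseteq> fst G \<and>
     proper_coloring (induced_subgraph G S) (chromatic_number G) c0 \<and>
     (\<exists>!c. proper_coloring G (chromatic_number G) c \<and> restrict c S = c0)"

text \<open>Meaningful for finite connected simple graphs of chromatic number at least 2.\<close>

definition sudoku_number :: "'a graph \<Rightarrow> nat" where
  "sudoku_number G = (LEAST s. \<exists>S c0. sudoku_coloring G S c0 \<and> card S = s)"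

text \<open>The vertices of the \<open>i\<close>-th copy of the complete graph on \<open>m\<close> vertices are \<open>(i, 1), \<dots>, (i, m)\<close>.
  The identification of the cycle edge \<open>x\<^sub>2\<^sub>i\<^sub>-\<^sub>1x\<^sub>2\<^sub>i\<close> with an edge of that copy is carried out
  by taking \<open>(i, 1)\<close> and \<open>(i, 2)\<close> as the cycle vertices \<open>x\<^sub>2\<^sub>i\<^sub>-\<^sub>1\<close> and \<open>x\<^sub>2\<^sub>i\<close>.\<close>

definition cycle_vertex :: "nat \<Rightarrow> nat \<times> nat" where
  "cycle_vertex t = (if odd t then ((t + 1) div 2, 1) else (t div 2, 2))"

definition cycle_edges :: "nat \<Rightarrow> (nat \<times> nat) set set" where
  "cycle_edges n =
     {{cycle_vertex t, cycle_vertex (t + 1)} | t. 1 \<le> t \<and> t < 2 * n}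
     \<union> {{cycle_vertex (2 * n), cycle_vertex 1}}"

definition clique_edges :: "nat \<Rightarrow> nat \<Rightarrow> (nat \<times> nat) set set" where
  "clique_edges m i = {{(i, j), (i, l)} | j l. j \<in> {1..m} \<and> l \<in> {1..m} \<and> j \<noteq> l}"

definition C2n_Km :: "nat \<Rightarrow> nat \<Rightarrow> (nat \<times> nat) graph" where
  "C2n_Km n m = ({1..n} \<times> {1..m}, cycle_edges n \<union> (\<Union>i\<in>{1..n}. clique_edges m i))"

definition C2n_Km_minus :: "nat \<Rightarrow> nat \<Rightarrow> (nat \<times> nat) graph" where
  "C2n_Km_minus n m =
     (fst (C2n_Km n m),
      snd (C2n_Km n m) - {{cycle_vertex (2 * i - 1), cycle_vertex (2 * i)} | i. i \<in> {1..n}})"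

lemma simple_graph_C2n_Km:
  assumes "n \<ge> 2" "m \<ge> 2"
  shows "simple_graph (C2n_Km n m)"
proof -
  have V: "cycle_vertex t \<in> {1..n} \<times> {1..m}" if "1 \<le> t" "t \<le> 2 * n" for t
  proof (cases "odd t")
    case True
    then have "(t + 1) div 2 \<in> {1..n}" using that by (auto elim: oddE)
    then show ?thesis using True assms by (simp add: cycle_vertex_def)
  next
    case False
    then have "t div 2 \<in> {1..n}" using that by (auto elim: evenE)
    then show ?thesis using False assms by (simp add: cycle_vertex_def)
  qed
  have ne: "cycle_vertex t \<noteq> cycle_vertex (t + 1)" for t
    by (simp add: cycle_vertex_def)
  have ne': "cycle_vertex (2 * n) \<noteq> cycle_vertex 1"
    by (simp add: cycle_vertex_def)
  have pair: "{u, v} \<subseteq> W \<and> card {u, v} = 2" if "u \<in> W" "v \<in> W" "u \<noteq> v"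
    for u v :: "nat \<times> nat" and W
    using that by simp
  have "e \<subseteq> {1..n} \<times> {1..m} \<and> card e = 2" if "e \<in> cycle_edges n" for e
  proof -
    from that consider t where "1 \<le> t" "t < 2 * n" "e = {cycle_vertex t, cycle_vertex (t + 1)}"
      | "e = {cycle_vertex (2 * n), cycle_vertex 1}"
      unfolding cycle_edges_def by blast
    then show ?thesis
    proof cases
      case 1
      then show ?thesis using pair[OF V[of t] V[of "t + 1"] ne[of t]] by simp
    next
      case 2
      then show ?thesis using pair[OF V[of "2 * n"] V[of 1] ne'] assms by simp
    qed
  qed
  moreover have "e \<subseteq> {1..n} \<times> {1..m} \<and> card e = 2"
    if "e \<in> clique_edges m i" "i \<in> {1..n}" for e i
    using that unfolding clique_edges_def by auto
  ultimately show ?thesis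
    unfolding simple_graph_def C2n_Km_def fst_conv snd_conv
    by (intro conjI ballI finite_cartesian_product finite_atLeastAtMost) blast+
qed

lemma simple_graph_C2n_Km_minus:
  assumes "n \<ge> 2" "m \<ge> 2"
  shows "simple_graph (C2n_Km_minus n m)"
  using simple_graph_C2n_Km[OF assms] by (auto simp: simple_graph_def C2n_Km_minus_def)

end

theory Submission
  imports Defs "HOL-Combinatorics.Transposition"
begin

text \<open>The chromatic number is \<open>m - 1\<close>, and an \<open>(m - 1)\<close>-coloring gives both ends of each removed
  edge the same color, so the colors of these ends form a proper coloring of an \<open>n\<close>-cycle of blocks.
  For the lower bound, two uncolored vertices among the remaining \<open>m - 2\<close> of a block could be
  swapped, so each block contains at least \<open>m - 3\<close> colored ones. If there are only \<open>(m - 3) n\<close>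
  colored vertices, the extensions are the colorings of a cycle from lists of size two, and such a
  coloring is never unique. For the upper bound, one further colored vertex in block \<open>1\<close> starts a
  chain of forced choices around the cycle, provided that the list of each block consists of its
  own color and the color of the preceding block.\<close>

section \<open>Periodic functions on the integers and two-list colorings of a cycle\<close>

lemma periodic_add_mult:
  fixes f :: "int \<Rightarrow> 'c"
  assumes "\<And>i. f (i + n) = f i"
  shows "f (i + k * n) = f i"
proof (induction k rule: int_induct[where k = 0])
  case (step1 k)
  then show ?case using assms[of "i + k * n"] by (simp add: algebra_simps)
next
  case (step2 k)
  then show ?case using assms[of "i + (k - 1) * n"] by (simp add: algebra_simps)
qed simp

lemma periodic_add_mod:
  fixes f :: "int \<Rightarrow> 'c"
  assumes "\<And>i. f (i + n) = f i"
  shows "f (i + z mod n) = f (i + z)"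
proof -
  have "i + z = (i + z mod n) + (z div n) * n" by simp
  then show ?thesis using periodic_add_mult[of f n "i + z mod n" "z div n"] assms by metis
qed

lemma int_mod_add_one:
  fixes z n :: int
  assumes "n \<ge> 1"
  shows "(z + 1) mod n = (if z mod n = n - 1 then 0 else z mod n + 1)"
proof -
  have "(z + 1) mod n = (z mod n + 1) mod n" by (simp add: mod_simps)
  moreover have "0 \<le> z mod n" "z mod n < n" using assms by auto
  ultimately show ?thesis by auto
qed

text \<open>Color greedily around the cycle, starting at \<open>p + 1\<close> with a color that is not available
  at \<open>p\<close> and preferring \<open>b\<close> over \<open>a\<close>: the last step cannot fail, so by uniqueness the
  alternative \<open>b\<close> must have been blocked at every step.\<close>

lemma unique_list_coloring_blocked_forward:
  fixes a b :: "int \<Rightarrow> 'c"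
  assumes n: "n \<ge> 1"
    and pa: "\<And>i. a (i + n) = a i" and pb: "\<And>i. b (i + n) = b i"
    and ab: "\<And>i. a i \<noteq> b i"
    and uniq: "\<And>c. (\<And>i. c (i + n) = c i) \<Longrightarrow> (\<And>i. c i \<in> {a i, b i}) \<Longrightarrow>
      (\<And>i. c i \<noteq> c (i + 1)) \<Longrightarrow> c = a"
    and x: "x \<in> {a (p + 1), b (p + 1)}" "x \<notin> {a p, b p}"
    and i: "\<not> n dvd (i - p)"
  shows "b (i + 1) = a i"
proof -
  define g where "g = rec_nat x (\<lambda>k y. if b (p + 1 + int (Suc k)) \<noteq> y
    then b (p + 1 + int (Suc k)) else a (p + 1 + int (Suc k)))"
  have g0: "g 0 = x" by (simp add: g_def)
  have gS: "g (Suc k) = (if b (p + 1 + int (Suc k)) \<noteq> g k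
    then b (p + 1 + int (Suc k)) else a (p + 1 + int (Suc k)))" for k
    by (simp add: g_def)
  have gmem: "g k \<in> {a (p + 1 + int k), b (p + 1 + int k)}" for k
    using x by (cases k) (auto simp: g0 gS)
  have gne: "g k \<noteq> g (Suc k)" for k
    using ab[of "p + 1 + int (Suc k)"] by (auto simp: gS simp del: of_nat_Suc)
  \<comment> \<open>\<open>g k\<close> is the color at position \<open>p + 1 + k\<close>, and
    \<open>c\<close> repeats its first \<open>n\<close> values. Residue \<open>0\<close> sits at
    \<open>p + 1\<close>, so the only seam lies between \<open>p\<close> and \<open>p + 1\<close>
    modulo \<open>n\<close>. There the start color \<open>x\<close> meets a list that does not
    contain it.\<close>
  define c where "c j = g (nat ((j - p - 1) mod n))" for j
  have nn: "int (nat (z mod n)) = z mod n" for z using n by simp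
  have cper: "c (j + n) = c j" for j
  proof -
    have "j + n - p - 1 = (j - p - 1) + n" by simp
    then show ?thesis unfolding c_def by (metis mod_add_self2)
  qed
  have red: "f (p + 1 + (j - p - 1) mod n) = f j" if "\<And>i. f (i + n) = f i"
    for f :: "int \<Rightarrow> 'c" and j
    using periodic_add_mod[of f n "p + 1" "j - p - 1"] that by simp
  have cmem: "c j \<in> {a j, b j}" for j
    using gmem[of "nat ((j - p - 1) mod n)"] red[of a j, OF pa] red[of b j, OF pb]
    unfolding c_def nn by simp
  have step: "(j + 1 - p - 1) mod n =
      (if (j - p - 1) mod n = n - 1 then 0 else (j - p - 1) mod n + 1)" for j
    using int_mod_add_one[OF n, of "j - p - 1"] by (simp add: algebra_simps)
  have suc: "nat ((j + 1 - p - 1) mod n) = Suc (nat ((j - p - 1) mod n))"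
    if "(j - p - 1) mod n \<noteq> n - 1" for j
    unfolding step using that n by (simp add: nat_add_distrib)
  have cne: "c j \<noteq> c (j + 1)" for j
  proof (cases "(j - p - 1) mod n = n - 1")
    case True
    have "c (j + 1) = x" unfolding c_def step using True by (simp add: g0)
    moreover have "a j = a p \<and> b j = b p"
    proof -
      have "p + 1 + (j - p - 1) mod n = p + n" using True by simp
      then show ?thesis using red[of a j, OF pa] red[of b j, OF pb] pa[of p] pb[of p] by metis
    qed
    ultimately show ?thesis using cmem[of j] x by auto
  next
    case False
    show ?thesis unfolding c_def suc[OF False] by (rule gne)
  qed
  have ca: "c = a" using uniq[of c] cper cmem cne by blast
  \<comment> \<open>The step from \<open>i\<close> to \<open>i + 1\<close> must avoid the seam,
    since only inside one round is the color at \<open>i + 1\<close> chosen by the greedy rule from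
    the color at \<open>i\<close>.\<close>
  have ik: "(i - p - 1) mod n \<noteq> n - 1"
  proof
    assume "(i - p - 1) mod n = n - 1"
    then have "(i - p) mod n = 0"
      using int_mod_add_one[OF n, of "i - p - 1"] by simp
    then show False using i by auto
  qed
  let ?k = "nat ((i - p - 1) mod n)"
  have "p + 1 + int (Suc ?k) = p + 1 + (i + 1 - p - 1) mod n"
    using suc[OF ik] nn by metis
  then have "b (p + 1 + int (Suc ?k)) = b (i + 1)" using red[of b "i + 1", OF pb] by simp
  moreover have "g (Suc ?k) = a (i + 1)" using ca suc[OF ik] unfolding c_def by metis
  moreover have "g ?k = a i" using ca unfolding c_def by metis
  ultimately show ?thesis using gS[of ?k] ab[of "i + 1"] by (auto split: if_splits)
qed

text \<open>The reflection \<open>j \<mapsto> - j\<close> reverses the orientation of the cycle. It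
  carries the edge from \<open>p\<close> to \<open>p + 1\<close> to the edge from
  \<open>- p - 1\<close> to \<open>- p\<close>, so this is the forward version for the reflected
  lists.\<close>

lemma unique_list_coloring_blocked_backward:
  fixes a b :: "int \<Rightarrow> 'c"
  assumes n: "n \<ge> 1"
    and pa: "\<And>i. a (i + n) = a i" and pb: "\<And>i. b (i + n) = b i"
    and ab: "\<And>i. a i \<noteq> b i"
    and uniq: "\<And>c. (\<And>i. c (i + n) = c i) \<Longrightarrow> (\<And>i. c i \<in> {a i, b i}) \<Longrightarrow>
      (\<And>i. c i \<noteq> c (i + 1)) \<Longrightarrow> c = a"
    and x: "x \<in> {a p, b p}" "x \<notin> {a (p + 1), b (p + 1)}"
    and i: "\<not> n dvd (i - p)"
  shows "b i = a (i + 1)"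
proof -
  have rev: "f (- (j + n)) = f (- j)" if "\<And>i. f (i + n) = f i" for f :: "int \<Rightarrow> 'c" and j
    using that[of "- (j + n)"] by simp
  have "b (- (- i - 1 + 1)) = a (- (- i - 1))"
  proof (rule unique_list_coloring_blocked_forward[where n = n and p = "- p - 1" and x = x
        and a = "\<lambda>j. a (- j)" and b = "\<lambda>j. b (- j)"])
    fix c :: "int \<Rightarrow> 'c"
    assume c: "\<And>i. c (i + n) = c i" "\<And>i. c i \<in> {a (- i), b (- i)}" "\<And>i. c i \<noteq> c (i + 1)"
    have "(\<lambda>j. c (- j)) = a"
    proof (rule uniq)
      show "c (- (j + n)) = c (- j)" for j using rev[of c] c(1) by blast
      show "c (- j) \<in> {a j, b j}" for j using c(2)[of "- j"] by simp
      show "c (- j) \<noteq> c (- (j + 1))" for j using c(3)[of "- (j + 1)"] by simp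
    qed
    then show "c = (\<lambda>j. a (- j))" by (metis minus_minus)
  next
    have "- i - 1 - (- p - 1) = - (i - p)" by simp
    then show "\<not> n dvd - i - 1 - (- p - 1)" using i by (metis dvd_minus_iff)
  qed (use n ab x rev pa pb in \<open>auto simp: algebra_simps\<close>)
  then show ?thesis by (simp add: algebra_simps)
qed

text \<open>Were the coloring unique with two different adjacent lists, both alternatives \<open>b\<close> would be
  blocked along the rest of the cycle, forcing all lists to agree. If all lists agree, exchanging
  the two colors everywhere gives another coloring.\<close>

lemma cycle_two_list_coloring_not_unique:
  fixes a b :: "int \<Rightarrow> 'c"
  assumes n: "n \<ge> 1"
    and pa: "\<And>i. a (i + n) = a i" and pb: "\<And>i. b (i + n) = b i"
    and ab: "\<And>i. a i \<noteq> b i" and aa: "\<And>i. a i \<noteq> a (i + 1)"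
  obtains c where "\<And>i. c (i + n) = c i" "\<And>i. c i \<in> {a i, b i}" "\<And>i. c i \<noteq> c (i + 1)" "c \<noteq> a"
proof (rule ccontr)
  assume no: "\<not> thesis"
  have uniq: "\<And>c. (\<And>i. c (i + n) = c i) \<Longrightarrow> (\<And>i. c i \<in> {a i, b i}) \<Longrightarrow>
      (\<And>i. c i \<noteq> c (i + 1)) \<Longrightarrow> c = a"
    using no that by blast
  have same: "{a p, b p} = {a (p + 1), b (p + 1)}" for p
  proof (rule ccontr)
    assume ne: "{a p, b p} \<noteq> {a (p + 1), b (p + 1)}"
    \<comment> \<open>Both lists have exactly two elements, so being different excludes inclusion
      either way. This yields a start color for each direction.\<close>
    have "\<not> {a (p + 1), b (p + 1)} \<subseteq> {a p, b p}" "\<not> {a p, b p} \<subseteq> {a (p + 1), b (p + 1)}"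
      using ne ab[of p] ab[of "p + 1"] by auto
    then obtain x y where x: "x \<in> {a (p + 1), b (p + 1)}" "x \<notin> {a p, b p}"
      and y: "y \<in> {a p, b p}" "y \<notin> {a (p + 1), b (p + 1)}"
      by (meson subsetI)
    have eq: "{a i, b i} = {a (i + 1), b (i + 1)}" if "\<not> n dvd (i - p)" for i
    proof -
      have "b (i + 1) = a i"
        by (rule unique_list_coloring_blocked_forward[where a = a and b = b, OF n pa pb ab uniq x that])
      moreover have "b i = a (i + 1)"
        by (rule unique_list_coloring_blocked_backward[where a = a and b = b, OF n pa pb ab uniq y that])
      ultimately show ?thesis by auto
    qed
    \<comment> \<open>Walk from \<open>p + 1\<close> to \<open>p + n\<close>, crossing every edge of
      the cycle except the one from \<open>p\<close> to \<open>p + 1\<close>. By periodicity the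
      list at \<open>p + n\<close> is the list at \<open>p\<close>, which contradicts
      \<open>ne\<close>.\<close>
    have "int k < n \<Longrightarrow> {a (p + 1 + int k), b (p + 1 + int k)} = {a (p + 1), b (p + 1)}" for k
    proof (induction k)
      case (Suc k)
      have "\<not> n dvd (p + 1 + int k - p)"
        using Suc.prems zdvd_not_zless[of "1 + int k" n] by simp
      from eq[OF this] Suc show ?case by (simp add: algebra_simps)
    qed simp
    from this[of "nat (n - 1)"] ne pa pb n show False by simp
  qed
  have "b = a"
  proof (rule uniq)
    show "b i \<noteq> b (i + 1)" for i using same[of i] aa[of i] by (metis doubleton_eq_iff)
  qed (use pb in auto)
  then show False using ab by auto
qed

section \<open>Edges and proper colorings of \<open>C2n_Km_minus\<close>\<close>

definition next_block :: "nat \<Rightarrow> nat \<Rightarrow> nat" where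
  "next_block n i = i mod n + 1"

lemma next_block_mem: "n \<ge> 1 \<Longrightarrow> next_block n i \<in> {1..n}"
  by (simp add: next_block_def Suc_leI)

lemma next_block_eq: "i \<in> {1..n} \<Longrightarrow> next_block n i = (if i = n then 1 else i + 1)"
  by (auto simp: next_block_def)

lemma cycle_vertex_even: "cycle_vertex (2 * i) = (i, 2)"
  by (simp add: cycle_vertex_def)

lemma cycle_vertex_odd: "cycle_vertex (2 * i + 1) = (i + 1, 1)"
  by (simp add: cycle_vertex_def)

lemma cycle_vertex_pred: "i \<ge> 1 \<Longrightarrow> cycle_vertex (2 * i - 1) = (i, 1)"
  using cycle_vertex_odd[of "i - 1"] by (cases i) simp_all

text \<open>The parity of \<open>t\<close> tells the edges inside a block from the links between
  consecutive blocks; the closing edge is the link from block \<open>n\<close> to block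
  \<open>1\<close>.\<close>

lemma cycle_edges_eq:
  assumes "n \<ge> 1"
  shows "cycle_edges n =
    {{(i, 1), (i, 2)} | i. i \<in> {1..n}} \<union> {{(i, 2), (next_block n i, 1)} | i. i \<in> {1..n}}"
    (is "_ = ?A \<union> ?B")
proof (intro equalityI subsetI)
  fix e assume "e \<in> cycle_edges n"
  then consider t where "1 \<le> t" "t < 2 * n" "e = {cycle_vertex t, cycle_vertex (t + 1)}"
    | "e = {cycle_vertex (2 * n), cycle_vertex 1}"
    unfolding cycle_edges_def by blast
  then show "e \<in> ?A \<union> ?B"
  proof cases
    case 1
    show ?thesis
    proof (cases "even t")
      case True
      then obtain i where i: "t = 2 * i" by (elim evenE)
      then have "e = {(i, 2), (next_block n i, 1)}" "i \<in> {1..n}"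
        using 1 cycle_vertex_even[of i] cycle_vertex_odd[of i] by (auto simp: next_block_eq)
      then show ?thesis by blast
    next
      case False
      then obtain i where i: "t = 2 * i + 1" by (elim oddE)
      then have "e = {(i + 1, 1), (i + 1, 2)}" "i + 1 \<in> {1..n}"
        using 1 cycle_vertex_even[of "i + 1"] cycle_vertex_odd[of i] by auto
      then show ?thesis by blast
    qed
  next
    case 2
    then have "e = {(n, 2), (next_block n n, 1)}"
      using cycle_vertex_even[of n] cycle_vertex_odd[of 0] by (simp add: next_block_def)
    then show ?thesis using assms by auto
  qed
next
  fix e assume "e \<in> ?A \<union> ?B"
  then consider i where "i \<in> {1..n}" "e = {(i, 1), (i, 2)}"
    | i where "i \<in> {1..n}" "e = {(i, 2), (next_block n i, 1)}" by blast
  then show "e \<in> cycle_edges n"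
  proof cases
    case 1
    then have "e = {cycle_vertex (2 * i - 1), cycle_vertex (2 * i - 1 + 1)}"
      "1 \<le> 2 * i - 1" "2 * i - 1 < 2 * n"
      using cycle_vertex_pred[of i] cycle_vertex_even[of i] by auto
    then show ?thesis unfolding cycle_edges_def by blast
  next
    case 2
    show ?thesis
    proof (cases "i = n")
      case True
      then have "e = {cycle_vertex (2 * n), cycle_vertex 1}"
        using 2 cycle_vertex_even[of n] cycle_vertex_odd[of 0] by (simp add: next_block_def)
      then show ?thesis unfolding cycle_edges_def by blast
    next
      case False
      then have "e = {cycle_vertex (2 * i), cycle_vertex (2 * i + 1)}" "1 \<le> 2 * i" "2 * i < 2 * n"
        using 2 cycle_vertex_even[of i] cycle_vertex_odd[of i] by (auto simp: next_block_eq)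
      then show ?thesis unfolding cycle_edges_def by blast
    qed
  qed
qed

text \<open>Since \<open>n \<ge> 2\<close>, a link joins two different blocks and is therefore not
  deleted; with a single block it would coincide with the removed edge.\<close>

lemma edges_C2n_Km_minus:
  assumes "n \<ge> 2"
  shows "{u, v} \<in> snd (C2n_Km_minus n m) \<longleftrightarrow>
    (\<exists>i\<in>{1..n}. {u, v} = {(i, 2), (next_block n i, 1)}) \<or>
    (\<exists>i\<in>{1..n}. \<exists>j\<in>{1..m}. \<exists>l\<in>{1..m}. j \<noteq> l \<and> {j, l} \<noteq> {1, 2} \<and> {u, v} = {(i, j), (i, l)})"
proof -
  have rem: "{{cycle_vertex (2 * i - 1), cycle_vertex (2 * i)} | i. i \<in> {1..n}}
      = {{(i, 1), (i, 2)} | i. i \<in> {1..n}}" (is "?R = ?R'")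
  proof -
    have "{cycle_vertex (2 * i - 1), cycle_vertex (2 * i)} = {(i, 1), (i, 2)}" if "i \<in> {1..n}" for i
      using that cycle_vertex_pred[of i] cycle_vertex_even[of i] by simp
    then show ?thesis by blast
  qed
  have ne: "{(i, 2), (next_block n i, 1)} \<noteq> {(k, 1), (k, 2 :: nat)}" if "i \<in> {1..n}" for i k :: nat
    using that assms by (auto simp: doubleton_eq_iff next_block_eq split: if_splits)
  have ne2: "{(i, j), (i, l)} \<noteq> {(k, 1), (k, 2)}" if "{j, l} \<noteq> {1, 2}" for i k j l :: nat
    using that by (auto simp: doubleton_eq_iff)
  have notR: "e \<notin> ?R'" if "\<And>k. e \<noteq> {(k, 1), (k, 2)}" for e
    using that by blast
  have S: "snd (C2n_Km_minus n m) = (cycle_edges n \<union> (\<Union>i\<in>{1..n}. clique_edges m i)) - ?R'"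
    unfolding C2n_Km_minus_def C2n_Km_def snd_conv rem ..
  have C: "cycle_edges n = ?R' \<union> {{(i, 2), (next_block n i, 1)} | i. i \<in> {1..n}}"
    using assms by (intro cycle_edges_eq) simp
  show ?thesis (is "?L \<longleftrightarrow> ?M")
  proof
    assume ?L
    then consider i where "i \<in> {1..n}" "{u, v} = {(i, 2), (next_block n i, 1)}"
      | i j l where "i \<in> {1..n}" "j \<in> {1..m}" "l \<in> {1..m}" "j \<noteq> l" "{u, v} = {(i, j), (i, l)}"
        "{u, v} \<notin> ?R'"
      unfolding S C clique_edges_def by blast
    then show ?M
    proof cases
      case (2 i j l)
      have "{j, l} \<noteq> {1, 2}"
      proof
        assume "{j, l} = {1, 2}"
        then have "{u, v} = {(i, 1), (i, 2)}" using 2(5) by (auto simp: doubleton_eq_iff)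
        then show False using 2(1,6) by blast
      qed
      then show ?thesis using 2 by blast
    qed blast
  next
    assume ?M
    then show ?L
    proof (elim disjE bexE conjE)
      fix i assume i: "i \<in> {1..n}" "{u, v} = {(i, 2), (next_block n i, 1)}"
      then have "{u, v} \<notin> ?R'" unfolding i(2) by (intro notR ne)
      moreover have "{u, v} \<in> cycle_edges n" 
        unfolding C i(2) using i(1) by (intro UnI2 CollectI exI[of _ i]) simp
      ultimately show ?thesis unfolding S by (intro DiffI UnI1)
    next
      fix i j l
      assume ijl: "i \<in> {1..n}" "j \<in> {1..m}" "l \<in> {1..m}" "j \<noteq> l" "{j, l} \<noteq> {1, 2}"
        "{u, v} = {(i, j), (i, l)}"
      then have "{u, v} \<notin> ?R'" unfolding ijl(6) by (intro notR ne2)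
      moreover have "{u, v} \<in> clique_edges m i"
        unfolding clique_edges_def ijl(6) using ijl by (intro CollectI exI[of _ j] exI[of _ l]) simp
      ultimately show ?thesis unfolding S using ijl(1) by (intro DiffI UnI2 UN_I)
    qed
  qed
qed

lemma vertices_C2n_Km_minus: "fst (C2n_Km_minus n m) = {1..n} \<times> {1..m}"
  by (simp add: C2n_Km_minus_def C2n_Km_def)

lemma proper_coloring_C2n_Km_minus:
  assumes "n \<ge> 2" "m \<ge> 2"
  shows "proper_coloring (C2n_Km_minus n m) k c \<longleftrightarrow>
    c \<in> {1..n} \<times> {1..m} \<rightarrow>\<^sub>E {1..k} \<and>
    (\<forall>i\<in>{1..n}. c (i, 2) \<noteq> c (next_block n i, 1)) \<and>
    (\<forall>i\<in>{1..n}. \<forall>j\<in>{1..m}. \<forall>l\<in>{1..m}. j \<noteq> l \<and> {j, l} \<noteq> {1, 2} \<longrightarrow> c (i, j) \<noteq> c (i, l))"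
    (is "_ \<longleftrightarrow> _ \<and> ?X \<and> ?Y")
proof -
  let ?E = "\<lambda>u v. {u, v} \<in> snd (C2n_Km_minus n m)"
  note E = edges_C2n_Km_minus[OF assms(1), of _ _ m]
  have "(\<forall>u v. ?E u v \<longrightarrow> c u \<noteq> c v) \<longleftrightarrow> ?X \<and> ?Y"
  proof (intro iffI conjI ballI impI allI)
    fix i assume "\<forall>u v. ?E u v \<longrightarrow> c u \<noteq> c v" "i \<in> {1..n}"
    moreover have "?E (i, 2) (next_block n i, 1)" unfolding E using \<open>i \<in> _\<close> by (intro disjI1 bexI[of _ i]) simp_all
    ultimately show "c (i, 2) \<noteq> c (next_block n i, 1)" by blast
  next
    fix i j l
    assume "\<forall>u v. ?E u v \<longrightarrow> c u \<noteq> c v"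
      and ijl: "i \<in> {1..n}" "j \<in> {1..m}" "l \<in> {1..m}" "j \<noteq> l \<and> {j, l} \<noteq> {1, 2}"
    moreover have "?E (i, j) (i, l)"
      unfolding E using ijl by (intro disjI2 bexI[of _ i] bexI[of _ j] bexI[of _ l]) simp_all
    ultimately show "c (i, j) \<noteq> c (i, l)" by blast
  next
    fix u v assume XY: "?X \<and> ?Y" and "?E u v"
    have sym: "c u \<noteq> c v" if "{u, v} = {x, y}" "c x \<noteq> c y" for x y
      using that by (metis doubleton_eq_iff)
    from \<open>?E u v\<close> show "c u \<noteq> c v" unfolding E
    proof (elim disjE bexE conjE)
      fix i assume i: "i \<in> {1..n}" "{u, v} = {(i, 2), (next_block n i, 1)}"
      then show ?thesis using XY by (intro sym[OF i(2)]) blast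
    next
      fix i j l
      assume ijl: "i \<in> {1..n}" "j \<in> {1..m}" "l \<in> {1..m}" "j \<noteq> l" "{j, l} \<noteq> {1, 2}"
        "{u, v} = {(i, j), (i, l)}"
      then show ?thesis using XY by (intro sym[OF ijl(6)]) blast
    qed
  qed
  then show ?thesis unfolding proper_coloring_def vertices_C2n_Km_minus by simp
qed

text \<open>With \<open>m - 1\<close> colors both ends of the removed edge receive the one color missing on the
  other \<open>m - 2\<close> vertices of their block.\<close>

lemma proper_coloring_C2n_Km_minus_iff:
  assumes n: "n \<ge> 2" and m: "m \<ge> 2"
  shows "proper_coloring (C2n_Km_minus n m) (m - 1) c \<longleftrightarrow>
    c \<in> {1..n} \<times> {1..m} \<rightarrow>\<^sub>E {1..m - 1} \<and>
    (\<forall>i\<in>{1..n}. c (i, 1) = c (i, 2) \<and> c (i, 1) \<noteq> c (next_block n i, 1) \<and>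
      inj_on (\<lambda>j. c (i, j)) {2..m})" (is "?L \<longleftrightarrow> ?R")
proof
  assume ?L
  then have c: "c \<in> {1..n} \<times> {1..m} \<rightarrow>\<^sub>E {1..m - 1}"
    and e: "\<And>i. i \<in> {1..n} \<Longrightarrow> c (i, 2) \<noteq> c (next_block n i, 1)"
    and d: "\<And>i j l. i \<in> {1..n} \<Longrightarrow> j \<in> {1..m} \<Longrightarrow> l \<in> {1..m} \<Longrightarrow> j \<noteq> l \<Longrightarrow> {j, l} \<noteq> {1, 2}
      \<Longrightarrow> c (i, j) \<noteq> c (i, l)"
    unfolding proper_coloring_C2n_Km_minus[OF n m] by blast+
  have "c (i, 1) = c (i, 2) \<and> inj_on (\<lambda>j. c (i, j)) {2..m}" if i: "i \<in> {1..n}" for i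
  proof
    show inj: "inj_on (\<lambda>j. c (i, j)) {2..m}"
    proof (rule inj_onI, rule ccontr)
      fix j l assume "j \<in> {2..m}" "l \<in> {2..m}" "c (i, j) = c (i, l)" "j \<noteq> l"
      then show False using d[OF i, of j l] by (auto simp: doubleton_eq_iff)
    qed
    \<comment> \<open>The \<open>m - 1\<close> vertices with index in \<open>{2..m}\<close> already
      use every color, so \<open>(i, 1)\<close> repeats one of theirs, and \<open>(i, 2)\<close> is
      the only one of them not adjacent to it.\<close>
    have "(\<lambda>j. c (i, j)) ` {2..m} \<subseteq> {1..m - 1}"
      using c i by (auto simp: PiE_iff)
    moreover have "card ((\<lambda>j. c (i, j)) ` {2..m}) = card {1..m - 1}"
      using card_image[OF inj] m by simp
    ultimately have "(\<lambda>j. c (i, j)) ` {2..m} = {1..m - 1}"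
      by (intro card_subset_eq) auto
    moreover have "c (i, 1) \<in> {1..m - 1}" using c i m by (auto simp: PiE_iff)
    ultimately have "c (i, 1) \<in> (\<lambda>j. c (i, j)) ` {2..m}" by (simp only:)
    then obtain j where j: "j \<in> {2..m}" "c (i, 1) = c (i, j)" by (rule imageE)
    have "j = 2"
    proof (rule ccontr)
      assume "j \<noteq> 2"
      then show False using d[OF i, of 1 j] j by (auto simp: doubleton_eq_iff)
    qed
    then show "c (i, 1) = c (i, 2)" using j by simp
  qed
  then show ?R using c e by metis
next
  assume R: ?R
  have "c (i, j) \<noteq> c (i, l)"
    if i: "i \<in> {1..n}" and jl: "j \<in> {1..m}" "l \<in> {1..m}" "j \<noteq> l" "{j, l} \<noteq> {1, 2}" for i j l
  proof -
    \<comment> \<open>Replacing index \<open>1\<close> by \<open>2\<close> keeps the color and moves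
      both indices into the range of injectivity. The only pair it merges is \<open>{1, 2}\<close>,
      which is excluded.\<close>
    define f where "f j = (if j = 1 then 2 else j)" for j :: nat
    have "c (i, j) = c (i, f j)" for j using R i by (auto simp: f_def)
    moreover have "f j \<noteq> f l" "f j \<in> {2..m}" "f l \<in> {2..m}"
      using jl m by (auto simp: f_def doubleton_eq_iff)
    moreover have "inj_on (\<lambda>j. c (i, j)) {2..m}" using R i by blast
    ultimately show ?thesis by (metis inj_on_eq_iff)
  qed
  then show ?L using R unfolding proper_coloring_C2n_Km_minus[OF n m] by metis
qed

section \<open>Lower bound on the number of colored vertices\<close>

text \<open>This supplies the competing colorings for the lower bound. A permutation of the colors
  inside a block preserves every condition within that block, so only the links between blocks have
  to be checked.\<close>

lemma proper_coloring_recolor_blocks: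
  assumes n: "n \<ge> 2" and m: "m \<ge> 2"
    and c: "proper_coloring (C2n_Km_minus n m) (m - 1) c"
    and \<pi>: "\<And>i. i \<in> {1..n} \<Longrightarrow> bij_betw (\<pi> i) {1..m - 1} {1..m - 1}"
    and ne: "\<And>i. i \<in> {1..n} \<Longrightarrow> \<pi> i (c (i, 1)) \<noteq> \<pi> (next_block n i) (c (next_block n i, 1))"
  shows "proper_coloring (C2n_Km_minus n m) (m - 1)
    (restrict (\<lambda>v. \<pi> (fst v) (c v)) ({1..n} \<times> {1..m}))" (is "proper_coloring _ _ ?d")
proof -
  note R = c[unfolded proper_coloring_C2n_Km_minus_iff[OF n m]]
  have ran: "c (i, j) \<in> {1..m - 1}" if "i \<in> {1..n}" "j \<in> {1..m}" for i j
    using R that by (auto simp: PiE_iff)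
  have d: "?d (i, j) = \<pi> i (c (i, j))" if "i \<in> {1..n}" "j \<in> {1..m}" for i j
    using that by simp
  have "?d \<in> {1..n} \<times> {1..m} \<rightarrow>\<^sub>E {1..m - 1}"
  proof (rule restrict_PiE_iff[THEN iffD2], rule ballI)
    fix v assume "v \<in> {1..n} \<times> {1..m}"
    then show "\<pi> (fst v) (c v) \<in> {1..m - 1}"
      using bij_betwE[OF \<pi>] ran by (cases v) auto
  qed
  moreover have "?d (i, 1) = ?d (i, 2) \<and> ?d (i, 1) \<noteq> ?d (next_block n i, 1) \<and>
      inj_on (\<lambda>j. ?d (i, j)) {2..m}" if i: "i \<in> {1..n}" for i
  proof (intro conjI)
    have i': "next_block n i \<in> {1..n}" using n by (intro next_block_mem) simp
    have 1: "1 \<in> {1..m}" "2 \<in> {1..m}" using m by auto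
    show "?d (i, 1) = ?d (i, 2)" unfolding d[OF i 1(1)] d[OF i 1(2)] using R i by simp
    show "?d (i, 1) \<noteq> ?d (next_block n i, 1)" unfolding d[OF i 1(1)] d[OF i' 1(1)] by (rule ne[OF i])
    show "inj_on (\<lambda>j. ?d (i, j)) {2..m}"
    proof (rule inj_onI)
      fix j l assume jl: "j \<in> {2..m}" "l \<in> {2..m}" and "?d (i, j) = ?d (i, l)"
      then have "\<pi> i (c (i, j)) = \<pi> i (c (i, l))" using i by simp
      moreover have "c (i, j) \<in> {1..m - 1}" "c (i, l) \<in> {1..m - 1}"
        using jl ran[OF i, of j] ran[OF i, of l] by simp_all
      ultimately have "c (i, j) = c (i, l)"
        by (rule inj_onD[OF bij_betw_imp_inj_on[OF \<pi>[OF i]]])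
      moreover have "inj_on (\<lambda>j. c (i, j)) {2..m}" using R i by blast
      ultimately show "j = l" using jl by (auto dest: inj_onD)
    qed
  qed
  ultimately show ?thesis unfolding proper_coloring_C2n_Km_minus_iff[OF n m] by blast
qed

lemma transpose_bij_betw:
  "x \<in> A \<Longrightarrow> y \<in> A \<Longrightarrow> bij_betw (transpose x y) A A"
  by (rule bij_betwI[where g = "transpose x y"]) (auto simp: transpose_def)

lemma sudoku_coloring_card_ge:
  assumes n: "n \<ge> 2" and m: "m \<ge> 4"
    and chr: "chromatic_number (C2n_Km_minus n m) = m - 1"
    and sud: "sudoku_coloring (C2n_Km_minus n m) S c0"
  shows "(m - 3) * n + 1 \<le> card S"
proof (rule ccontr)
  assume small: "\<not> (m - 3) * n + 1 \<le> card S"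
  have m2: "m \<ge> 2" using m by simp
  let ?V = "{1..n} \<times> {1..m}"
  have SV: "S \<subseteq> ?V" and ex1: "\<exists>!c. proper_coloring (C2n_Km_minus n m) (m - 1) c \<and> restrict c S = c0"
    using sud chr unfolding sudoku_coloring_def vertices_C2n_Km_minus by auto
  have fS: "finite S" using SV by (rule finite_subset) simp
  from ex1 obtain c where c: "proper_coloring (C2n_Km_minus n m) (m - 1) c" "restrict c S = c0"
    by blast
  have uniq: "d v = c v"
    if "proper_coloring (C2n_Km_minus n m) (m - 1) d" "\<And>v. v \<in> S \<Longrightarrow> d v = c v" for d v
  proof -
    have "restrict d S = c0" unfolding c(2)[symmetric] by (rule restrict_ext) (rule that(2))
    then show ?thesis using ex1 that(1) c by metis
  qed
  note R = c(1)[unfolded proper_coloring_C2n_Km_minus_iff[OF n m2]]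
  have ran: "c (i, j) \<in> {1..m - 1}" if "i \<in> {1..n}" "j \<in> {1..m}" for i j
    using R that by (auto simp: PiE_iff)
  have inj: "c (i, j) = c (i, l) \<longleftrightarrow> j = l" if "i \<in> {1..n}" "j \<in> {2..m}" "l \<in> {2..m}" for i j l
    using R that by (metis inj_on_eq_iff)
  have u12: "c (i, 1) = c (i, 2)" and une: "c (i, 1) \<noteq> c (next_block n i, 1)"
    if "i \<in> {1..n}" for i
    using R that by blast+
  have nb: "next_block n i \<in> {1..n}" for i using n by (intro next_block_mem) simp
  define W where "W i = {j \<in> {3..m}. (i, j) \<in> S}" for i
  define U where "U i = {j \<in> {3..m}. (i, j) \<notin> S}" for i
  have U1: "j = l" if i: "i \<in> {1..n}" and jl: "j \<in> U i" "l \<in> U i" for i j l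
  proof (rule ccontr)
    assume "j \<noteq> l"
    \<comment> \<open>Exchange the colors of the two free vertices \<open>(i, j)\<close> and
      \<open>(i, l)\<close>. No other vertex of the block has either color, so every colored vertex
      and every cycle vertex keeps its own.\<close>
    define \<pi> where "\<pi> k = (if k = i then transpose (c (i, j)) (c (i, l)) else id)" for k
    have r: "j \<in> {3..m}" "l \<in> {3..m}" using jl by (auto simp: U_def)
    have fix1: "\<pi> k (c (k, 1)) = c (k, 1)" if "k \<in> {1..n}" for k
      using inj[OF i, of 2 j] inj[OF i, of 2 l] u12[OF i] r m
      by (auto simp: \<pi>_def transpose_def)
    let ?d = "restrict (\<lambda>v. \<pi> (fst v) (c v)) ?V"
    have "?d (i, j) = c (i, j)"
    proof (rule uniq)
      show "proper_coloring (C2n_Km_minus n m) (m - 1) ?d"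
      proof (rule proper_coloring_recolor_blocks[OF n m2 c(1)])
        show "bij_betw (\<pi> k) {1..m - 1} {1..m - 1}" for k
          using transpose_bij_betw ran[OF i] r by (auto simp: \<pi>_def)
      qed (use fix1 nb une in metis)
    next
      fix v assume v: "v \<in> S"
      show "?d v = c v"
      proof (cases "fst v = i \<and> snd v \<in> {2..m}")
        case True
        then obtain q where q: "v = (i, q)" "q \<in> {2..m}" by (metis prod.collapse)
        have "q \<noteq> j" "q \<noteq> l" using v q jl by (auto simp: U_def)
        then show ?thesis using q v SV inj[OF i, of q j] inj[OF i, of q l] r
          by (auto simp: \<pi>_def transpose_def)
      next
        case False
        then have "fst v \<noteq> i \<or> v = (fst v, 1)" using v SV by (cases v) auto
        then show ?thesis using v SV fix1[of "fst v"] by (cases v) (auto simp: \<pi>_def)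
      qed
    qed
    then show False using inj[OF i, of j l] r i \<open>j \<noteq> l\<close> by (auto simp: \<pi>_def)
  qed
  have cardW: "m - 3 \<le> card (W i)" if i: "i \<in> {1..n}" for i
  proof -
    have "card (U i) \<le> 1" using U1[OF i] by (auto simp: card_le_Suc0_iff_eq U_def)
    moreover have "W i \<union> U i = {3..m}" "W i \<inter> U i = {}" by (auto simp: W_def U_def)
    then have "card (W i) + card (U i) = card {3..m}"
      by (metis card_Un_disjoint finite_Un finite_atLeastAtMost)
    ultimately show ?thesis by simp
  qed
  have SW: "Sigma {1..n} W \<subseteq> S" by (auto simp: W_def)
  have cardSW: "card (Sigma {1..n} W) = (\<Sum>i\<in>{1..n}. card (W i))"
    by (rule card_SigmaI) (auto simp: W_def)
  have le: "(m - 3) * n \<le> (\<Sum>i\<in>{1..n}. card (W i))"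
    using sum_bounded_below[of "{1..n}" "m - 3" "\<lambda>i. card (W i)"] cardW by (simp add: mult.commute)
  \<comment> \<open>The bounds \<open>small\<close> and \<open>le\<close> leave no room outside
    \<open>Sigma {1..n} W\<close>; in particular no cycle vertex is colored.\<close>
  have SeqW: "S = Sigma {1..n} W"
    using card_seteq[OF fS SW] small le cardSW by simp
  \<comment> \<open>Equality in the count also forbids a block with more than \<open>m - 3\<close>
    colored vertices, so each block has a free vertex beyond its two cycle vertices.\<close>
  have Une: "U i \<noteq> {}" if i: "i \<in> {1..n}" for i
  proof
    assume "U i = {}"
    then have "W i = {3..m}" by (auto simp: U_def W_def)
    then have "m - 3 < card (W i)" using m by simp
    then have "(\<Sum>i\<in>{1..n}. m - 3) < (\<Sum>i\<in>{1..n}. card (W i))"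
      using cardW i by (intro sum_strict_mono_ex1) auto
    then show False using small SeqW cardSW by (simp add: mult.commute)
  qed
  define w where "w i = (SOME j. j \<in> U i)" for i
  have w: "w i \<in> {3..m}" "(i, w i) \<notin> S" if "i \<in> {1..n}" for i
    using Une[OF that] some_in_eq[of "U i"] by (auto simp: U_def w_def)
  \<comment> \<open>Position \<open>z\<close> on the integer line stands for block
    \<open>z mod n + 1\<close>, so block \<open>i\<close> is found at position
    \<open>i - 1\<close>.\<close>
  define pos where "pos z = nat (z mod int n) + 1" for z
  have pos_mem: "pos z \<in> {1..n}" for z
    using n by (simp add: pos_def Suc_le_eq nat_less_iff)
  have pos_Suc: "pos (z + 1) = next_block n (pos z)" for z
  proof -
    have "int (nat (z mod int n) + 1) mod int n = (z + 1) mod int n"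
      using n by (simp add: mod_simps add.commute)
    then show ?thesis unfolding pos_def next_block_def
      by (metis nat_int zmod_int)
  qed
  have pos_per: "pos (z + int n) = pos z" for z by (simp add: pos_def)
  have pos_int: "pos (int i - 1) = i" if "i \<in> {1..n}" for i
    using that by (simp add: pos_def nat_diff_distrib)
  \<comment> \<open>The list at a block consists of the two colors that its colored vertices do not
    use: the common color of the cycle vertices and the color of the free vertex
    \<open>w\<close>.\<close>
  obtain e where e: "\<And>z. e (z + int n) = e z" "\<And>z. e z \<in> {c (pos z, 1), c (pos z, w (pos z))}"
    "\<And>z. e z \<noteq> e (z + 1)" "e \<noteq> (\<lambda>z. c (pos z, 1))"
  proof (rule cycle_two_list_coloring_not_unique[where n = "int n" and a = "\<lambda>z. c (pos z, 1)"
        and b = "\<lambda>z. c (pos z, w (pos z))"])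
    show "c (pos z, 1) \<noteq> c (pos z, w (pos z))" for z
      using inj[OF pos_mem, of 2 "w (pos z)" z] u12[OF pos_mem] w[OF pos_mem, of z] m by auto
    show "c (pos z, 1) \<noteq> c (pos (z + 1), 1)" for z
      unfolding pos_Suc by (rule une[OF pos_mem])
  qed (use n pos_per in auto)
  \<comment> \<open>Where \<open>e\<close> departs from \<open>c\<close>, swap the two list colors
    in that block. The colored vertices have neither color, so \<open>uniq\<close> will force
    \<open>e\<close> back to the original coloring.\<close>
  define \<pi> where "\<pi> i = (if e (int i - 1) = c (i, 1) then id else transpose (c (i, 1)) (c (i, w i)))" for i
  have \<pi>1: "\<pi> i (c (i, 1)) = e (int i - 1)" if "i \<in> {1..n}" for i
    using e(2)[of "int i - 1"] pos_int[OF that] by (auto simp: \<pi>_def)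
  let ?d = "restrict (\<lambda>v. \<pi> (fst v) (c v)) ?V"
  have e_pos: "e (int (pos z) - 1) = e z" for z
  proof -
    have "int (pos z) - 1 = 0 + z mod int n" using n by (simp add: pos_def)
    then show ?thesis using periodic_add_mod[of e "int n" 0 z] e(1) by simp
  qed
  have same: "?d v = c v" for v
  proof (rule uniq)
    show "proper_coloring (C2n_Km_minus n m) (m - 1) ?d"
    proof (rule proper_coloring_recolor_blocks[OF n m2 c(1)])
      fix i assume i: "i \<in> {1..n}"
      show "bij_betw (\<pi> i) {1..m - 1} {1..m - 1}"
        using transpose_bij_betw ran[OF i] w[OF i] m by (auto simp: \<pi>_def)
      have "pos (int i) = next_block n i"
        using pos_Suc[of "int i - 1"] pos_int[OF i] by simp
      then have "\<pi> (next_block n i) (c (next_block n i, 1)) = e (int i)"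
        using \<pi>1[OF nb, of i] e_pos[of "int i"] by simp
      then show "\<pi> i (c (i, 1)) \<noteq> \<pi> (next_block n i) (c (next_block n i, 1))"
        using \<pi>1[OF i] e(3)[of "int i - 1"] by simp
    qed
  next
    fix v assume "v \<in> S"
    then have "v \<in> Sigma {1..n} W" by (subst (asm) SeqW)
    then obtain i j where v: "v = (i, j)" "i \<in> {1..n}" "j \<in> {3..m}" "(i, j) \<in> S"
      by (auto simp: W_def)
    have "j \<noteq> w i" using v w by blast
    then have "c v \<noteq> c (i, 1)" "c v \<noteq> c (i, w i)"
      using inj[OF v(2), of j 2] inj[OF v(2), of j "w i"] u12[OF v(2)] w[OF v(2)] v by auto
    then show "?d v = c v" using v by (auto simp: \<pi>_def)
  qed
  have "e z = c (pos z, 1)" for z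
    using same[of "(pos z, 1)"] \<pi>1[OF pos_mem, of z] pos_mem[of z] e_pos[of z] m by auto
  then show False using e(4) by auto
qed

section \<open>Standard coloring, chromatic number and upper bound\<close>

text \<open>The color \<open>cycle_color n i\<close> of block \<open>i\<close> alternates around the cycle, the third color
  being used once when \<open>n\<close> is odd; index \<open>0\<close> stands for block \<open>n\<close>.\<close>

definition cycle_color :: "nat \<Rightarrow> nat \<Rightarrow> nat" where
  "cycle_color n i = (if i = 0 \<or> i = n then if even n then 2 else 3 else if odd i then 1 else 2)"

lemma cycle_color_mem: "m \<ge> 4 \<Longrightarrow> cycle_color n i \<in> {1..m - 1}"
  by (auto simp: cycle_color_def)

lemma cycle_color_pred: "n \<ge> 2 \<Longrightarrow> i \<in> {1..n} \<Longrightarrow> cycle_color n (i - 1) \<noteq> cycle_color n i"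
  by (auto simp: cycle_color_def split: if_splits)

lemma cycle_color_next:
  assumes "n \<ge> 2" "i \<in> {1..n}"
  shows "cycle_color n (next_block n i - 1) = cycle_color n i"
  using assms by (auto simp: next_block_eq cycle_color_def)

text \<open>Vertex \<open>(i, 3)\<close> is given the color of the preceding block so that, once the
  vertices with index at least \<open>4\<close> are fixed, the list of block \<open>i\<close> is its
  own color and the preceding one. The other \<open>m - 3\<close> colors go bijectively to the
  indices in \<open>{4..m}\<close>.\<close>

lemma obtain_standard_coloring:
  assumes n: "n \<ge> 2" and m: "m \<ge> 4"
  obtains c where "proper_coloring (C2n_Km_minus n m) (m - 1) c"
    "\<And>i. i \<in> {1..n} \<Longrightarrow> c (i, 1) = cycle_color n i"
    "\<And>i. i \<in> {1..n} \<Longrightarrow> c (i, 3) = cycle_color n (i - 1)"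
proof -
  let ?V = "{1..n} \<times> {1..m}"
  let ?a = "cycle_color n"
  have "\<exists>h. bij_betw h {4..m} ({1..m - 1} - {?a i, ?a (i - 1)})" if "i \<in> {1..n}" for i
  proof -
    have "card ({1..m - 1} - {?a i, ?a (i - 1)}) = card {1..m - 1} - card {?a i, ?a (i - 1)}"
      using cycle_color_mem[OF m] by (intro card_Diff_subset) auto
    then have "card ({1..m - 1} - {?a i, ?a (i - 1)}) = card {4..m}"
      using cycle_color_pred[OF n that] m by simp
    then show ?thesis by (intro finite_same_card_bij) auto
  qed
  then obtain h where h: "\<And>i. i \<in> {1..n} \<Longrightarrow> bij_betw (h i) {4..m} ({1..m - 1} - {?a i, ?a (i - 1)})"
    by metis
  define f where "f i j = (if j \<le> 2 then ?a i else if j = 3 then ?a (i - 1) else h i j)" for i j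
  let ?c = "restrict (\<lambda>(i, j). f i j) ?V"
  have c: "?c (i, j) = f i j" if "i \<in> {1..n}" "j \<in> {1..m}" for i j using that by simp
  have hm: "h i j \<in> {1..m - 1} - {?a i, ?a (i - 1)}" if "i \<in> {1..n}" "j \<in> {4..m}" for i j
    using bij_betwE[OF h[OF that(1)]] that(2) by blast
  have "proper_coloring (C2n_Km_minus n m) (m - 1) ?c"
  proof (subst proper_coloring_C2n_Km_minus_iff)
    have "f i j \<in> {1..m - 1}" if "i \<in> {1..n}" "j \<in> {1..m}" for i j
    proof (cases "j \<le> 3")
      case False
      then show ?thesis using hm[OF that(1), of j] that by (simp add: f_def)
    qed (use cycle_color_mem[OF m, of n] in \<open>simp add: f_def\<close>)
    then have "?c \<in> ?V \<rightarrow>\<^sub>E {1..m - 1}" by (auto simp: restrict_PiE_iff)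
    moreover have "?c (i, 1) = ?c (i, 2) \<and> ?c (i, 1) \<noteq> ?c (next_block n i, 1) \<and>
        inj_on (\<lambda>j. ?c (i, j)) {2..m}" if i: "i \<in> {1..n}" for i
    proof (intro conjI)
      have i': "next_block n i \<in> {1..n}" using n by (intro next_block_mem) simp
      have j: "1 \<in> {1..m}" "2 \<in> {1..m}" using m by auto
      show "?c (i, 1) = ?c (i, 2)" unfolding c[OF i j(1)] c[OF i j(2)] by (simp add: f_def)
      show "?c (i, 1) \<noteq> ?c (next_block n i, 1)"
        unfolding c[OF i j(1)] c[OF i' j(1)]
        using cycle_color_pred[OF n i'] cycle_color_next[OF n i] by (simp add: f_def)
      have "inj_on (f i) {2..m}"
      proof -
        have eq: "{2..m} = insert 2 (insert 3 {4..m})" using m by auto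
        have "inj_on (f i) {4..m}"
          using bij_betw_imp_inj_on[OF h[OF i]] by (simp add: f_def inj_on_def)
        moreover have "f i ` {4..m} = {1..m - 1} - {?a i, ?a (i - 1)}"
          using bij_betw_imp_surj_on[OF h[OF i]] by (simp add: f_def)
        then have "f i 2 \<notin> f i ` {4..m}" "f i 3 \<notin> f i ` {4..m}" by (simp_all add: f_def)
        moreover have "f i 2 \<noteq> f i 3" using cycle_color_pred[OF n i] by (simp add: f_def)
        ultimately show ?thesis unfolding eq inj_on_insert by blast
      qed
      then show "inj_on (\<lambda>j. ?c (i, j)) {2..m}"
        using i by (simp add: inj_on_def)
    qed
    ultimately show "?c \<in> ?V \<rightarrow>\<^sub>E {1..m - 1} \<and> (\<forall>i\<in>{1..n}. ?c (i, 1) = ?c (i, 2) \<and>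
        ?c (i, 1) \<noteq> ?c (next_block n i, 1) \<and> inj_on (\<lambda>j. ?c (i, j)) {2..m})"
      by blast
  qed (use n m in auto)
  then show thesis
    by (rule that) (use m in \<open>auto simp: f_def\<close>)
qed

text \<open>Within block \<open>1\<close> only the edge between \<open>(1, 1)\<close> and
  \<open>(1, 2)\<close> is missing, so \<open>(1, 2), ..., (1, m)\<close> form a clique on
  \<open>m - 1\<close> vertices; the standard coloring attains this bound.\<close>

lemma chromatic_number_C2n_Km_minus:
  assumes n: "n \<ge> 2" and m: "m \<ge> 4"
  shows "chromatic_number (C2n_Km_minus n m) = m - 1"
  unfolding chromatic_number_def
proof (rule Least_equality)
  show "\<exists>c. proper_coloring (C2n_Km_minus n m) (m - 1) c"
    using obtain_standard_coloring[OF n m] by metis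
next
  fix k assume "\<exists>c. proper_coloring (C2n_Km_minus n m) k c"
  then obtain c where c: "proper_coloring (C2n_Km_minus n m) k c" ..
  have m2: "m \<ge> 2" using m by simp
  note R = c[unfolded proper_coloring_C2n_Km_minus[OF n m2]]
  have "inj_on (\<lambda>j. c (1, j)) {2..m}"
  proof (rule inj_onI, rule ccontr)
    fix j l assume "j \<in> {2..m}" "l \<in> {2..m}" "c (1, j) = c (1, l)" "j \<noteq> l"
    then show False using R n by (auto simp: doubleton_eq_iff Ball_def)
  qed
  moreover have "(\<lambda>j. c (1, j)) ` {2..m} \<subseteq> {1..k}"
    using R n by (auto simp: PiE_iff)
  ultimately have "card {2..m} \<le> card {1..k}"
    by (intro card_inj_on_le[where f = "\<lambda>j. c (1, j)"]) auto
  then show "m - 1 \<le> k" by simp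
qed

lemma exists_sudoku_coloring:
  assumes n: "n \<ge> 2" and m: "m \<ge> 4"
  shows "\<exists>S c0. sudoku_coloring (C2n_Km_minus n m) S c0 \<and> card S = (m - 3) * n + 1"
proof -
  let ?V = "{1..n} \<times> {1..m}"
  let ?G = "C2n_Km_minus n m"
  let ?a = "cycle_color n"
  have m2: "m \<ge> 2" using m by simp
  obtain c where c: "proper_coloring ?G (m - 1) c"
    and c1: "\<And>i. i \<in> {1..n} \<Longrightarrow> c (i, 1) = ?a i"
    and c3: "\<And>i. i \<in> {1..n} \<Longrightarrow> c (i, 3) = ?a (i - 1)"
    using obtain_standard_coloring[OF n m] by metis
  define S where "S = insert (1, 1) ({1..n} \<times> {4..m})"
  have SV: "S \<subseteq> ?V" using n m by (auto simp: S_def)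
  have "card S = (m - 3) * n + 1"
    by (simp add: S_def mult.commute)
  have im: "(\<lambda>j. d (i, j)) ` {2..m} = {1..m - 1}" "inj_on (\<lambda>j. d (i, j)) {2..m}"
    "d (i, 1) = d (i, 2)" "d (i, 1) \<noteq> d (next_block n i, 1)"
    if "proper_coloring ?G (m - 1) d" "i \<in> {1..n}" for d i
  proof -
    note R = that(1)[unfolded proper_coloring_C2n_Km_minus_iff[OF n m2]]
    show inj: "inj_on (\<lambda>j. d (i, j)) {2..m}" and "d (i, 1) = d (i, 2)"
      "d (i, 1) \<noteq> d (next_block n i, 1)"
      using R that(2) by blast+
    show "(\<lambda>j. d (i, j)) ` {2..m} = {1..m - 1}"
    proof (rule card_subset_eq)
      show "(\<lambda>j. d (i, j)) ` {2..m} \<subseteq> {1..m - 1}" using R that(2) by (auto simp: PiE_iff)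
      show "card ((\<lambda>j. d (i, j)) ` {2..m}) = card {1..m - 1}" using card_image[OF inj] m by simp
    qed simp
  qed
  have split: "{2..m} = {2, 3} \<union> {4..m}" using m by auto
  \<comment> \<open>The vertices with index in \<open>{4..m}\<close> use up \<open>m - 3\<close> of
    the \<open>m - 1\<close> colors. Hence colorings that agree on them share the two-element list
    left for indices \<open>2\<close> and \<open>3\<close>.\<close>
  have rest: "{d (i, 2), d (i, 3)} = {1..m - 1} - (\<lambda>j. d (i, j)) ` {4..m}" "d (i, 2) \<noteq> d (i, 3)"
    if "proper_coloring ?G (m - 1) d" "i \<in> {1..n}" for d i
  proof -
    note I = im(1,2)[OF that]
    have "(\<lambda>j. d (i, j)) ` {2, 3} \<inter> (\<lambda>j. d (i, j)) ` {4..m} = {}"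
      using I(2) m by (subst inj_on_image_Int[symmetric, where C = "{2..m}"]) auto
    then show "{d (i, 2), d (i, 3)} = {1..m - 1} - (\<lambda>j. d (i, j)) ` {4..m}"
      using I(1) unfolding split image_Un by auto
    show "d (i, 2) \<noteq> d (i, 3)" using inj_onD[OF I(2), of 2 3] m by auto
  qed
  have "d = c" if d: "proper_coloring ?G (m - 1) d" and S: "restrict d S = restrict c S" for d
  proof -
    have dS: "d v = c v" if "v \<in> S" for v using S that by (metis restrict_apply')
    have lists: "{d (i, 1), d (i, 3)} = {?a i, ?a (i - 1)}" "d (i, 1) \<noteq> d (i, 3)"
      if i: "i \<in> {1..n}" for i
    proof -
      have "(\<lambda>j. d (i, j)) ` {4..m} = (\<lambda>j. c (i, j)) ` {4..m}"
        using dS i by (intro image_cong) (auto simp: S_def)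
      then show "{d (i, 1), d (i, 3)} = {?a i, ?a (i - 1)}" "d (i, 1) \<noteq> d (i, 3)"
        using rest[OF d i] rest[OF c i] im(3)[OF d i] im(3)[OF c i] c1[OF i] c3[OF i] by auto
    qed
    \<comment> \<open>Block \<open>1\<close> is settled by the extra vertex \<open>(1, 1)\<close> of
      \<open>S\<close>. After that, the list of block \<open>Suc i\<close> offers the colors of
      blocks \<open>Suc i\<close> and \<open>i\<close>, and the link from block \<open>i\<close>
      rules out the latter.\<close>
    have d1: "i \<in> {1..n} \<Longrightarrow> d (i, 1) = ?a i" for i
    proof (induction i)
      case (Suc i)
      show ?case
      proof (cases "i = 0")
        case True
        then show ?thesis using dS[of "(1, 1)"] c1[of 1] n by (simp add: S_def)
      next
        case False
        then have i: "i \<in> {1..n}" "next_block n i = Suc i" using Suc.prems by (auto simp: next_block_eq)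
        then have "d (Suc i, 1) \<noteq> ?a i" using im(4)[OF d i(1)] Suc.IH by simp
        then show ?thesis using lists(1)[OF Suc.prems] by (auto simp: doubleton_eq_iff)
      qed
    qed simp
    have "d (i, j) = c (i, j)" if i: "i \<in> {1..n}" and j: "j \<in> {1..m}" for i j
    proof -
      have 1: "d (i, 1) = c (i, 1)" using d1[OF i] c1[OF i] by simp
      have 2: "d (i, 2) = c (i, 2)" using 1 im(3)[OF d i] im(3)[OF c i] by simp
      \<comment> \<open>With the cycle color of the block known, \<open>(i, 3)\<close> is left with
        the other color of the list.\<close>
      have 3: "d (i, 3) = c (i, 3)"
        using lists[OF i] d1[OF i] c3[OF i] by (auto simp: doubleton_eq_iff)
      have "j = 1 \<or> j = 2 \<or> j = 3 \<or> (i, j) \<in> S" using i j by (auto simp: S_def)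
      then show ?thesis using 1 2 3 dS by auto
    qed
    moreover have "d \<in> extensional ?V" "c \<in> extensional ?V"
      using c d unfolding proper_coloring_C2n_Km_minus_iff[OF n m2] PiE_def by blast+
    ultimately show ?thesis by (intro extensionalityI[of d ?V c]) auto
  qed
  moreover have "proper_coloring (induced_subgraph ?G S) (m - 1) (restrict c S)"
    using c SV unfolding proper_coloring_def induced_subgraph_def vertices_C2n_Km_minus
    by (auto simp: restrict_PiE_iff PiE_iff)
  ultimately have "sudoku_coloring ?G S (restrict c S)"
    using c SV unfolding sudoku_coloring_def chromatic_number_C2n_Km_minus[OF n m]
      vertices_C2n_Km_minus by blast
  then show ?thesis using \<open>card S = _\<close> by blast
qed

theorem theorem3p11:
  fixes n m :: nat
  assumes "n \<ge> 2" and "m \<ge> 4"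
  shows "sudoku_number (C2n_Km_minus n m) = (m - 3) * n + 1"
  unfolding sudoku_number_def
proof (rule Least_equality)
  show "\<exists>S c0. sudoku_coloring (C2n_Km_minus n m) S c0 \<and> card S = (m - 3) * n + 1"
    by (rule exists_sudoku_coloring[OF assms])
qed (use sudoku_coloring_card_ge[OF assms chromatic_number_C2n_Km_minus[OF assms]] in blast)

end
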